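(* Let $m\ge 2$, let $\Gamma$ be a compact Lie group acting linearly on a finite-dimensional complex vector space $V$, let $\sigma:\Gamma\to\mathbf{Z}_m$ be a group epimorphism with kernel $K=\ker\sigma$, and let $\delta\in\Gamma$ be such that $\sigma(\delta)$ is a primitive $m$-th root of unity. Let $\{u_1,\ldots,u_s\}$ be a Hilbert basis of $\mathcal{P}(K)$. Then, for each $j\in\{1,\ldots,m-1\}$, the $\sigma^j$-relative invariants $$R_1(u_1)^{\alpha_{11}}\cdots R_1(u_s)^{\alpha_{1s}}\cdots R_{m-1}(u_1)^{\alpha_{m-1,1}}\cdots R_{m-1}(u_s)^{\alpha_{m-1,s}},$$ with non-negative integers $\alpha_{li}$ ($1\le l\le m-1$, $1\le i\le s$) such that $$\sum_{l=1}^{m-1} l\,(\alpha_{l1}+\cdots+\alpha_{ls})\equiv j \pmod m,$$ form a generating set of the module $\mathcal{P}_{\sigma^j}(\Gamma)$ over the ring $\mathcal{P}(\Gamma)$.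
   Context: $\mathbf{Z}_m\subset\mathbf{C}^{*}$ is the cyclic group of $m$-th roots of unity, and $\sigma^j(\gamma)=\sigma(\gamma)^j$. Polynomial functions on $V$ have complex coefficients. $\mathcal{P}(\Gamma)$ (resp. $\mathcal{P}(K)$) is the ring of polynomial functions $f:V\to\mathbf{C}$ with $f(\gamma x)=f(x)$ for all $x\in V$ and all $\gamma\in\Gamma$ (resp. all $\gamma\in K$). A Hilbert basis of $\mathcal{P}(K)$ is a finite set of elements generating it as a $\mathbf{C}$-algebra. $\mathcal{P}_{\sigma^j}(\Gamma)$ is the $\mathcal{P}(\Gamma)$-module of $\sigma^j$-relative invariants, i.e. polynomial functions $f:V\to\mathbf{C}$ with $f(\gamma x)=\sigma^j(\gamma)f(x)$ for all $\gamma\in\Gamma$, $x\in V$. For $0\le j\le m-1$ the $\sigma^j$-relative Reynolds operator $R_j:\mathcal{P}(K)\to\mathcal{P}(K)$ is $$R_j(f)(x)=\frac1m\sum_{k=0}^{m-1}\overline{\sigma(\delta)^{jk}}\,f(\delta^k x),$$ where the bar denotes complex conjugation. *)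

theory Defs
  imports "HOL-Analysis.Analysis" "HOL-Algebra.Algebra" "HOL-Number_Theory.Cong"
begin

section \<open>Compact Lie groups\<close>

text \<open>
  The model space is the library's \<^const>\<open>Euclidean_space\<close> \<open>n\<close>, the sequences \<open>x :: nat \<Rightarrow> real\<close> with
  \<open>x i = 0\<close> for \<open>i \<ge> n\<close>. Its dimension is a number, and \<open>n = 0\<close> is allowed, so that finite groups are
  (zero-dimensional) compact Lie groups.
\<close>

definition partial_deriv :: "nat \<Rightarrow> ((nat \<Rightarrow> real) \<Rightarrow> real) \<Rightarrow> (nat \<Rightarrow> real) \<Rightarrow> real" where
  "partial_deriv i g x = deriv (\<lambda>t. g (x(i := t))) (x i)"

text \<open>\<open>Ck_on n k U g\<close>: on the open set \<open>U\<close> of \<open>n\<close>-space all partial derivatives of \<open>g\<close> of order at most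
  \<open>k\<close> exist and are continuous.\<close>

primrec Ck_on :: "nat \<Rightarrow> nat \<Rightarrow> (nat \<Rightarrow> real) set \<Rightarrow> ((nat \<Rightarrow> real) \<Rightarrow> real) \<Rightarrow> bool" where
  "Ck_on n 0 U g \<longleftrightarrow> continuous_map (subtopology (Euclidean_space n) U) euclideanreal g"
| "Ck_on n (Suc k) U g \<longleftrightarrow>
     continuous_map (subtopology (Euclidean_space n) U) euclideanreal g \<and>
     (\<forall>i<n. (\<forall>x\<in>U. (\<lambda>t. g (x(i := t))) differentiable (at (x i))) \<and>
            Ck_on n k U (partial_deriv i g))"

definition smooth_map ::
    "nat \<Rightarrow> nat \<Rightarrow> (nat \<Rightarrow> real) set \<Rightarrow> ((nat \<Rightarrow> real) \<Rightarrow> nat \<Rightarrow> real) \<Rightarrow> bool" where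
  "smooth_map n p U f \<longleftrightarrow> (\<forall>i<p. \<forall>k. Ck_on n k U (\<lambda>x. f x i))"

text \<open>A chart is a pair \<open>(D, \<phi>)\<close> of its domain and its coordinate map; \<open>\<phi>\<close> is only relevant on \<open>D\<close>.\<close>

type_synonym 'a chart = "'a set \<times> ('a \<Rightarrow> nat \<Rightarrow> real)"

definition is_chart :: "nat \<Rightarrow> 'a topology \<Rightarrow> 'a chart \<Rightarrow> bool" where
  "is_chart n T c \<longleftrightarrow> (case c of (D, \<phi>) \<Rightarrow>
     openin T D \<and> openin (Euclidean_space n) (\<phi> ` D) \<and>
     homeomorphic_map (subtopology T D) (subtopology (Euclidean_space n) (\<phi> ` D)) \<phi>)"

definition smooth_atlas :: "nat \<Rightarrow> 'a topology \<Rightarrow> 'a chart set \<Rightarrow> bool" where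
  "smooth_atlas n T A \<longleftrightarrow>
     (\<forall>c\<in>A. is_chart n T c) \<and> (\<Union>(D, \<phi>)\<in>A. D) = topspace T \<and>
     (\<forall>(D, \<phi>)\<in>A. \<forall>(E, \<psi>)\<in>A. smooth_map n n (\<phi> ` (D \<inter> E)) (\<lambda>x. \<psi> (inv_into D \<phi> x)))"

definition smooth_manifold :: "nat \<Rightarrow> 'a topology \<Rightarrow> 'a chart set \<Rightarrow> bool" where
  "smooth_manifold n T A \<longleftrightarrow> Hausdorff_space T \<and> second_countable T \<and> smooth_atlas n T A"

text \<open>The two halves of a point of \<open>2n\<close>-space, identified with the product of two copies of
  \<open>n\<close>-space.\<close>

definition fst_half :: "nat \<Rightarrow> (nat \<Rightarrow> real) \<Rightarrow> nat \<Rightarrow> real" where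
  "fst_half n z = (\<lambda>i. if i < n then z i else 0)"

definition snd_half :: "nat \<Rightarrow> (nat \<Rightarrow> real) \<Rightarrow> nat \<Rightarrow> real" where
  "snd_half n z = (\<lambda>i. z (n + i))"

text \<open>Smoothness of multiplication and inversion is smoothness of their expressions in charts, each on
  the open set where that expression is defined; \<^const>\<open>inv_into\<close> is the inverse chart.\<close>

definition lie_group ::
    "nat \<Rightarrow> 'a chart set \<Rightarrow> 'a topology \<Rightarrow> ('a, 'm) monoid_scheme \<Rightarrow> bool" where
  "lie_group n A T G \<longleftrightarrow>
     group G \<and> topspace T = carrier G \<and> smooth_manifold n T A \<and>
     continuous_map (prod_topology T T) T (\<lambda>(x, y). x \<otimes>\<^bsub>G\<^esub> y) \<and>
     continuous_map T T (\<lambda>x. inv\<^bsub>G\<^esub> x) \<and>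
     (\<forall>(D, \<phi>)\<in>A. \<forall>(E, \<psi>)\<in>A. \<forall>(F, \<theta>)\<in>A.
        let pr = (\<lambda>z. inv_into D \<phi> (fst_half n z) \<otimes>\<^bsub>G\<^esub> inv_into E \<psi> (snd_half n z))
        in smooth_map (2 * n) n
             {z \<in> topspace (Euclidean_space (2 * n)).
                fst_half n z \<in> \<phi> ` D \<and> snd_half n z \<in> \<psi> ` E \<and> pr z \<in> F}
             (\<lambda>z. \<theta> (pr z))) \<and>
     (\<forall>(D, \<phi>)\<in>A. \<forall>(F, \<theta>)\<in>A.
        let iv = (\<lambda>x. inv\<^bsub>G\<^esub> (inv_into D \<phi> x))
        in smooth_map n n {x \<in> \<phi> ` D. iv x \<in> F} (\<lambda>x. \<theta> (iv x)))"

definition compact_lie_group ::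
    "nat \<Rightarrow> 'a chart set \<Rightarrow> 'a topology \<Rightarrow> ('a, 'm) monoid_scheme \<Rightarrow> bool" where
  "compact_lie_group n A T G \<longleftrightarrow> lie_group n A T G \<and> compact_space T"


section \<open>Linear actions on a finite-dimensional complex vector space\<close>

text \<open>The usual topology of a finite-dimensional complex vector space with basis \<open>B\<close>: the one
  transported from the coordinate space. It does not depend on the choice of \<open>B\<close>; coordinates outside \<open>B\<close> vanish.\<close>

definition vs_topology :: "(complex \<Rightarrow> 'v \<Rightarrow> 'v) \<Rightarrow> 'v::ab_group_add set \<Rightarrow> 'v topology" where
  "vs_topology smul B =
     pullback_topology UNIV (module.representation smul B) (product_topology (\<lambda>_. euclidean) UNIV)"

definition acts_linearly ::
    "('a, 'm) monoid_scheme \<Rightarrow> 'a topology \<Rightarrow> (complex \<Rightarrow> 'v \<Rightarrow> 'v) \<Rightarrow> 'v::ab_group_add set \<Rightarrow>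
     ('a \<Rightarrow> 'v \<Rightarrow> 'v) \<Rightarrow> bool" where
  "acts_linearly G T smul B act \<longleftrightarrow>
     group_action G UNIV act \<and>
     (\<forall>\<gamma>\<in>carrier G. Vector_Spaces.linear smul smul (act \<gamma>)) \<and>
     continuous_map (prod_topology T (vs_topology smul B)) (vs_topology smul B) (\<lambda>(\<gamma>, x). act \<gamma> x)"


section \<open>Roots of unity\<close>

definition root_of_unity_group :: "nat \<Rightarrow> complex monoid" where
  "root_of_unity_group m = \<lparr>carrier = {z. z ^ m = 1}, mult = (*), one = 1\<rparr>"

definition primitive_root_of_unity :: "nat \<Rightarrow> complex \<Rightarrow> bool" where
  "primitive_root_of_unity m z \<longleftrightarrow> z ^ m = 1 \<and> (\<forall>k. 0 < k \<and> k < m \<longrightarrow> z ^ k \<noteq> 1)"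


section \<open>Polynomial functions, invariants and relative invariants\<close>

inductive_set algebra_generated :: "('v \<Rightarrow> complex) set \<Rightarrow> ('v \<Rightarrow> complex) set"
  for S :: "('v \<Rightarrow> complex) set" where
  generator: "f \<in> S \<Longrightarrow> f \<in> algebra_generated S"
| const: "(\<lambda>_. c) \<in> algebra_generated S"
| add: "f \<in> algebra_generated S \<Longrightarrow> g \<in> algebra_generated S \<Longrightarrow>
        (\<lambda>x. f x + g x) \<in> algebra_generated S"
| mult: "f \<in> algebra_generated S \<Longrightarrow> g \<in> algebra_generated S \<Longrightarrow>
         (\<lambda>x. f x * g x) \<in> algebra_generated S"

text \<open>Polynomial functions are the polynomials in the complex-linear forms, equivalently in the
  coordinates for any basis.\<close>

definition polynomial_functions :: "(complex \<Rightarrow> 'v \<Rightarrow> 'v) \<Rightarrow> ('v::ab_group_add \<Rightarrow> complex) set" where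
  "polynomial_functions smul = algebra_generated {l. Vector_Spaces.linear smul (*) l}"

definition invariant_polys ::
    "(complex \<Rightarrow> 'v \<Rightarrow> 'v) \<Rightarrow> ('a \<Rightarrow> 'v \<Rightarrow> 'v) \<Rightarrow> 'a set \<Rightarrow> ('v::ab_group_add \<Rightarrow> complex) set" where
  "invariant_polys smul act H =
     {f \<in> polynomial_functions smul. \<forall>\<gamma>\<in>H. \<forall>x. f (act \<gamma> x) = f x}"

definition relative_invariant_polys ::
    "(complex \<Rightarrow> 'v \<Rightarrow> 'v) \<Rightarrow> ('a \<Rightarrow> 'v \<Rightarrow> 'v) \<Rightarrow> 'a set \<Rightarrow> ('a \<Rightarrow> complex) \<Rightarrow> nat \<Rightarrow>
     ('v::ab_group_add \<Rightarrow> complex) set" where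
  "relative_invariant_polys smul act H \<sigma> j =
     {f \<in> polynomial_functions smul. \<forall>\<gamma>\<in>H. \<forall>x. f (act \<gamma> x) = \<sigma> \<gamma> ^ j * f x}"

definition hilbert_basis :: "('v \<Rightarrow> complex) set \<Rightarrow> ('v \<Rightarrow> complex) set \<Rightarrow> bool" where
  "hilbert_basis P U \<longleftrightarrow> finite U \<and> U \<subseteq> P \<and> algebra_generated U = P"

definition reynolds ::
    "('a, 'm) monoid_scheme \<Rightarrow> ('a \<Rightarrow> 'v \<Rightarrow> 'v) \<Rightarrow> ('a \<Rightarrow> complex) \<Rightarrow> 'a \<Rightarrow> nat \<Rightarrow> nat \<Rightarrow>
     ('v \<Rightarrow> complex) \<Rightarrow> 'v \<Rightarrow> complex" where
  "reynolds G act \<sigma> \<delta> m j f =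
     (\<lambda>x. 1 / of_nat m * (\<Sum>k<m. cnj (\<sigma> \<delta> ^ (j * k)) * f (act (\<delta> [^]\<^bsub>G\<^esub> k) x)))"

text \<open>\<open>M\<close> generates the module \<open>N\<close> of functions over the ring \<open>R\<close> of functions; \<open>M\<close> may be infinite,
  the linear combinations are finite.\<close>

definition generates_module ::
    "('v \<Rightarrow> complex) set \<Rightarrow> ('v \<Rightarrow> complex) set \<Rightarrow> ('v \<Rightarrow> complex) set \<Rightarrow> bool" where
  "generates_module R N M \<longleftrightarrow>
     M \<subseteq> N \<and>
     N = {\<lambda>x. \<Sum>h\<in>F. p h x * h x | F p. finite F \<and> F \<subseteq> M \<and> (\<forall>h\<in>F. p h \<in> R)}"

end

theory Submission
  imports Defs
begin

text \<open>
  Every \<open>K\<close>-invariant \<open>f\<close> is the sum of its Reynolds projections \<open>R\<^sub>l f\<close>, and \<open>R\<^sub>0 f\<close> is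
  \<open>\<Gamma>\<close>-invariant. Substituting \<open>u\<^sub>i = \<Sum>\<^sub>l R\<^sub>l u\<^sub>i\<close>, each element of \<open>\<P>(K)\<close> becomes a
  \<open>\<P>(\<Gamma>)\<close>-linear combination of monomials in the \<open>R\<^sub>l u\<^sub>i\<close> with \<open>l \<ge> 1\<close>. The operator \<open>R\<^sub>j\<close>
  fixes the monomials of weight \<open>j\<close> modulo \<open>m\<close> and annihilates the others, so applying it to a
  \<open>\<sigma>\<^sup>j\<close>-relative invariant leaves only the terms of weight \<open>j\<close>.
\<close>

section \<open>Powers of a primitive root of unity\<close>

lemma primitive_root_power_eq_iff:
  assumes "primitive_root_of_unity m w" "m > 0"
  shows "w ^ a = w ^ b \<longleftrightarrow> [a = b] (mod m)"
proof -
  have w1: "w ^ m = 1" and prim: "\<And>k. 0 < k \<Longrightarrow> k < m \<Longrightarrow> w ^ k \<noteq> 1"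
    using assms(1) by (auto simp: primitive_root_of_unity_def)
  have w0: "w \<noteq> 0" using w1 assms(2) by (auto simp: zero_power)
  have red: "w ^ k = w ^ (k mod m)" for k
  proof -
    have "w ^ k = w ^ (m * (k div m) + k mod m)" by simp
    also have "\<dots> = w ^ (k mod m)" by (simp only: power_add power_mult w1 power_one mult_1)
    finally show ?thesis .
  qed
  \<comment> \<open>Cancelling \<open>w ^ x\<close> from a coincidence with \<open>x < y < m\<close>
    would give \<open>w ^ (y - x) = 1\<close> with \<open>0 < y - x < m\<close>, against
    primitivity.\<close>
  have inj: "x = y" if "x \<le> y" "y < m" "w ^ x = w ^ y" for x y
  proof (rule ccontr)
    assume "x \<noteq> y"
    with that have d: "0 < y - x" "y - x < m" by auto
    have "w ^ y = w ^ x * w ^ (y - x)" using that(1) by (simp flip: power_add)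
    then have "w ^ (y - x) = 1" using that(3) w0 by auto
    with prim[OF d] show False by simp
  qed
  show ?thesis
  proof
    assume "w ^ a = w ^ b"
    then have e: "w ^ (a mod m) = w ^ (b mod m)" using red by metis
    have "a mod m < m" "b mod m < m" using assms(2) by auto
    with e inj have "a mod m = b mod m" by (metis nle_le)
    then show "[a = b] (mod m)" by (simp add: cong_def)
  next
    assume "[a = b] (mod m)"
    then show "w ^ a = w ^ b" using red by (metis cong_def)
  qed
qed

text \<open>A counting argument: the powers below \<open>m\<close> are pairwise distinct, and there
  are exactly \<open>m\<close> roots of unity to be hit. It serves to express every value of
  \<sigma> through \<open>\<sigma> \<delta>\<close>.\<close>

lemma primitive_root_powers:
  assumes "primitive_root_of_unity m w" "m > 0" "z ^ m = 1"
  obtains k where "k < m" "z = w ^ k"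
proof -
  have w1: "w ^ m = 1" using assms(1) by (simp add: primitive_root_of_unity_def)
  have "inj_on (\<lambda>k. w ^ k) {..<m}"
    by (rule inj_onI) (use primitive_root_power_eq_iff[OF assms(1,2)] in \<open>auto simp: cong_def\<close>)
  then have "card ((\<lambda>k. w ^ k) ` {..<m}) = card {z::complex. z ^ m = 1}"
    by (simp add: card_image card_roots_unity_eq assms(2))
  moreover have "(\<lambda>k. w ^ k) ` {..<m} \<subseteq> {z. z ^ m = 1}"
    using w1 by (auto simp: power_commuting_commutes) (metis mult.commute power_mult power_one)
  moreover have "finite {z::complex. z ^ m = 1}"
    using assms(2) by (intro finite_roots_unity) auto
  ultimately have "(\<lambda>k. w ^ k) ` {..<m} = {z. z ^ m = 1}"
    by (metis card_subset_eq)
  with assms(3) show ?thesis using that by blast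
qed

text \<open>The geometric sum has numerator \<open>z ^ m - 1 = 0\<close> unless
  \<open>z = 1\<close>. This is the orthogonality of characters behind all computations with
  Reynolds operators.\<close>

lemma sum_powers_root_of_unity:
  fixes z :: complex
  assumes "z ^ m = 1"
  shows "(\<Sum>k<m. z ^ k) = (if z = 1 then of_nat m else 0)"
  using assms by (simp add: geometric_sum)

section \<open>Closure properties of generated algebras and of spans over a ring of
  functions\<close>

lemma algebra_generated_sum:
  assumes "\<And>i. i \<in> I \<Longrightarrow> f i \<in> algebra_generated S"
  shows "(\<lambda>x. \<Sum>i\<in>I. f i x) \<in> algebra_generated S"
  using assms
  by (induction I rule: infinite_finite_induct)
     (auto intro: algebra_generated.const algebra_generated.add)

text \<open>Precomposition with \<open>L\<close> respects sums and products and carries linear forms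
  to linear forms, so induction over the generation of \<open>f\<close> applies.\<close>

lemma polynomial_functions_compose_linear:
  assumes "Vector_Spaces.linear smul smul L" "f \<in> polynomial_functions smul"
  shows "(\<lambda>x. f (L x)) \<in> polynomial_functions smul"
  using assms(2) unfolding polynomial_functions_def
proof induction
  case (generator f)
  then have "Vector_Spaces.linear smul (*) (f \<circ> L)"
    using assms(1) by (auto intro: Vector_Spaces.linear_compose)
  then show ?case by (auto intro: algebra_generated.generator simp: comp_def)
qed (auto intro: algebra_generated.const algebra_generated.add algebra_generated.mult)

text \<open>The right-hand side of the equation in \<open>generates_module\<close>, separated from
  the module \<open>N\<close> so that its closure properties can be proved for any \<open>R\<close>
  and \<open>M\<close>.\<close>

definition module_span :: "('v \<Rightarrow> complex) set \<Rightarrow> ('v \<Rightarrow> complex) set \<Rightarrow> ('v \<Rightarrow> complex) set" where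
  "module_span R M =
     {\<lambda>x. \<Sum>h\<in>F. p h x * h x | F p. finite F \<and> F \<subseteq> M \<and> (\<forall>h\<in>F. p h \<in> R)}"

lemma module_span_term: "p \<in> R \<Longrightarrow> h \<in> M \<Longrightarrow> (\<lambda>x. p x * h x) \<in> module_span R M"
  unfolding module_span_def by (rule CollectI, rule exI[of _ "{h}"], rule exI[of _ "\<lambda>_. p"]) auto

lemma module_span_zero: "(\<lambda>_. 0) \<in> module_span R M"
  unfolding module_span_def by (rule CollectI, rule exI[of _ "{}"]) auto

lemma module_span_add:
  assumes zero: "(\<lambda>_. 0) \<in> R" and add: "\<And>p q. p \<in> R \<Longrightarrow> q \<in> R \<Longrightarrow> (\<lambda>x. p x + q x) \<in> R"
    and f: "f \<in> module_span R M" and g: "g \<in> module_span R M"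
  shows "(\<lambda>x. f x + g x) \<in> module_span R M"
proof -
  obtain F p where F: "finite F" "F \<subseteq> M" "\<forall>h\<in>F. p h \<in> R" and f': "f = (\<lambda>x. \<Sum>h\<in>F. p h x * h x)"
    using f unfolding module_span_def by blast
  obtain E q where E: "finite E" "E \<subseteq> M" "\<forall>h\<in>E. q h \<in> R" and g': "g = (\<lambda>x. \<Sum>h\<in>E. q h x * h x)"
    using g unfolding module_span_def by blast
  \<comment> \<open>The two combinations may run over different finite sets. Extending both
    coefficient families by zero, which lies in \<open>R\<close>, lets them run over
    \<open>F \<union> E\<close>.\<close>
  define p' where "p' h = (if h \<in> F then p h else (\<lambda>_. 0))" for h
  define q' where "q' h = (if h \<in> E then q h else (\<lambda>_. 0))" for h
  have "f = (\<lambda>x. \<Sum>h\<in>F \<union> E. p' h x * h x)" "g = (\<lambda>x. \<Sum>h\<in>F \<union> E. q' h x * h x)"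
    unfolding f' g' p'_def q'_def
    by (auto intro!: sum.mono_neutral_cong_left simp: F(1) E(1))
  then have "(\<lambda>x. f x + g x) = (\<lambda>x. \<Sum>h\<in>F \<union> E. (p' h x + q' h x) * h x)"
    by (simp add: sum.distrib distrib_right)
  moreover have "\<forall>h\<in>F \<union> E. (\<lambda>x. p' h x + q' h x) \<in> R"
    using F(3) E(3) zero by (auto simp: p'_def q'_def intro!: add)
  ultimately show ?thesis
    unfolding module_span_def using F(1,2) E(1,2)
    by (intro CollectI exI[of _ "F \<union> E"] exI[of _ "\<lambda>h x. p' h x + q' h x"]) auto
qed

lemma module_span_sum:
  assumes "(\<lambda>_. 0) \<in> R" "\<And>p q. p \<in> R \<Longrightarrow> q \<in> R \<Longrightarrow> (\<lambda>x. p x + q x) \<in> R"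
    and "\<And>i. i \<in> I \<Longrightarrow> f i \<in> module_span R M"
  shows "(\<lambda>x. \<Sum>i\<in>I. f i x) \<in> module_span R M"
  using assms(3)
  by (induction I rule: infinite_finite_induct)
     (auto intro: module_span_zero module_span_add[OF assms(1,2)])

lemma module_span_mult:
  assumes zero: "(\<lambda>_. 0) \<in> R" and add: "\<And>p q. p \<in> R \<Longrightarrow> q \<in> R \<Longrightarrow> (\<lambda>x. p x + q x) \<in> R"
    and mult: "\<And>p q. p \<in> R \<Longrightarrow> q \<in> R \<Longrightarrow> (\<lambda>x. p x * q x) \<in> R"
    and M: "\<And>h k. h \<in> M \<Longrightarrow> k \<in> M \<Longrightarrow> (\<lambda>x. h x * k x) \<in> M"
    and f: "f \<in> module_span R M" and g: "g \<in> module_span R M"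
  shows "(\<lambda>x. f x * g x) \<in> module_span R M"
proof -
  obtain F p where F: "finite F" "F \<subseteq> M" "\<forall>h\<in>F. p h \<in> R" and f': "f = (\<lambda>x. \<Sum>h\<in>F. p h x * h x)"
    using f unfolding module_span_def by blast
  obtain E q where E: "finite E" "E \<subseteq> M" "\<forall>h\<in>E. q h \<in> R" and g': "g = (\<lambda>x. \<Sum>h\<in>E. q h x * h x)"
    using g unfolding module_span_def by blast
  \<comment> \<open>Each term of the double sum is a coefficient in \<open>R\<close> times a
    generator \<open>h x * k x\<close> in \<open>M\<close>. Pairs with the same product need no
    regrouping, since \<open>module_span_sum\<close> adds the terms.\<close>
  have "(\<lambda>x. f x * g x) = (\<lambda>x. \<Sum>h\<in>F. \<Sum>k\<in>E. (p h x * q k x) * (h x * k x))"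
    unfolding f' g' by (simp add: sum_product mult_ac)
  also have "\<dots> \<in> module_span R M"
    using F E by (intro module_span_sum[OF zero add] module_span_term mult M) auto
  finally show ?thesis .
qed

section \<open>Relative invariants of a character with values in the roots of unity\<close>

locale cyclic_character =
  fixes G :: "('a, 'm) monoid_scheme" (structure)
    and smul :: "complex \<Rightarrow> 'v::ab_group_add \<Rightarrow> 'v"
    and act :: "'a \<Rightarrow> 'v \<Rightarrow> 'v" and \<sigma> :: "'a \<Rightarrow> complex" and \<delta> :: 'a and m :: nat
  assumes action: "group_action G UNIV act"
    and act_linear: "\<gamma> \<in> carrier G \<Longrightarrow> Vector_Spaces.linear smul smul (act \<gamma>)"
    and \<sigma>_hom: "\<sigma> \<in> hom G (root_of_unity_group m)"
    and \<delta>_carrier: "\<delta> \<in> carrier G"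
    and \<delta>_primitive: "primitive_root_of_unity m (\<sigma> \<delta>)"
    and m_pos: "m > 0"
begin

sublocale group G
  using action group_action.group_hom group_hom.axioms(1) by blast

abbreviation "rel j \<equiv> relative_invariant_polys smul act (carrier G) \<sigma> j"
abbreviation "inv\<Gamma> \<equiv> invariant_polys smul act (carrier G)"
abbreviation "invK \<equiv> invariant_polys smul act (kernel G (root_of_unity_group m) \<sigma>)"
abbreviation "R j \<equiv> reynolds G act \<sigma> \<delta> m j"

lemma \<sigma>_mult: "x \<in> carrier G \<Longrightarrow> y \<in> carrier G \<Longrightarrow> \<sigma> (x \<otimes> y) = \<sigma> x * \<sigma> y"
  using \<sigma>_hom by (auto simp: hom_def root_of_unity_group_def)

lemma \<sigma>_root: "x \<in> carrier G \<Longrightarrow> \<sigma> x ^ m = 1"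
  using \<sigma>_hom by (auto simp: hom_def root_of_unity_group_def)

lemma \<sigma>_nonzero: "x \<in> carrier G \<Longrightarrow> \<sigma> x \<noteq> 0"
  using \<sigma>_root[of x] m_pos by (auto simp: zero_power)

lemma \<sigma>_one: "\<sigma> \<one> = 1"
  using \<sigma>_mult[of \<one> \<one>] \<sigma>_nonzero[of \<one>] by simp

lemma \<sigma>_pow: "x \<in> carrier G \<Longrightarrow> \<sigma> (x [^] (k::nat)) = \<sigma> x ^ k"
  by (induction k) (simp_all add: \<sigma>_one \<sigma>_mult mult.commute)

text \<open>A root of unity has modulus 1, so conjugation inverts it; hence the conjugated weights
  in \<open>reynolds\<close> cancel values of the character.\<close>

lemma cnj_\<sigma>: "x \<in> carrier G \<Longrightarrow> cnj (\<sigma> x) * \<sigma> x = 1"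
proof -
  assume "x \<in> carrier G"
  then have "norm (\<sigma> x) ^ m = 1" by (metis \<sigma>_root norm_one norm_power)
  then have "norm (\<sigma> x) = 1"
    using m_pos by (metis power_eq_1_iff less_not_refl2 abs_norm_cancel real_norm_def)
  then show ?thesis by (simp add: complex_norm_square[symmetric] mult.commute)
qed

lemma act_mult:
  "x \<in> carrier G \<Longrightarrow> y \<in> carrier G \<Longrightarrow> act (x \<otimes> y) v = act x (act y v)"
  by (rule group_action.composition_rule[OF action]) auto

lemma act_one: "act \<one> v = v"
  using group_action.id_eq_one[OF action] by (metis UNIV_I restrict_apply')

lemma relI:
  assumes "f \<in> polynomial_functions smul"
    and "\<And>\<gamma> x. \<gamma> \<in> carrier G \<Longrightarrow> f (act \<gamma> x) = \<sigma> \<gamma> ^ j * f x"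
  shows "f \<in> rel j"
  using assms by (auto simp: relative_invariant_polys_def)

lemma rel_poly: "f \<in> rel j \<Longrightarrow> f \<in> polynomial_functions smul"
  by (auto simp: relative_invariant_polys_def)

lemma rel_act: "f \<in> rel j \<Longrightarrow> \<gamma> \<in> carrier G \<Longrightarrow> f (act \<gamma> x) = \<sigma> \<gamma> ^ j * f x"
  by (auto simp: relative_invariant_polys_def)

lemma rel_0: "rel 0 = inv\<Gamma>"
  by (simp add: relative_invariant_polys_def invariant_polys_def)

lemma rel_subset_invK: "rel j \<subseteq> invK"
  by (auto simp: relative_invariant_polys_def invariant_polys_def kernel_def root_of_unity_group_def)

lemma rel_const: "(\<lambda>_. c) \<in> rel 0"
  by (rule relI) (auto simp: polynomial_functions_def intro: algebra_generated.const)

lemma rel_add: "f \<in> rel j \<Longrightarrow> g \<in> rel j \<Longrightarrow> (\<lambda>x. f x + g x) \<in> rel j"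
  by (rule relI)
     (auto simp: rel_act distrib_left polynomial_functions_def
           dest!: rel_poly intro: algebra_generated.add)

text \<open>The relative invariants form a grading. The index is a natural number here, so that
  degrees simply add; \<open>rel_cong\<close> reduces them modulo \<open>m\<close>
  afterwards.\<close>

lemma rel_mult: "f \<in> rel i \<Longrightarrow> g \<in> rel j \<Longrightarrow> (\<lambda>x. f x * g x) \<in> rel (i + j)"
  by (rule relI)
     (auto simp: rel_act power_add polynomial_functions_def
           dest!: rel_poly intro: algebra_generated.mult)

lemma rel_zero: "(\<lambda>_. 0) \<in> rel j"
  by (rule relI) (auto simp: polynomial_functions_def intro: algebra_generated.const)

lemma rel_sum:
  "(\<And>i. i \<in> I \<Longrightarrow> f i \<in> rel j) \<Longrightarrow> (\<lambda>x. \<Sum>i\<in>I. f i x) \<in> rel j"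
  by (induction I rule: infinite_finite_induct) (auto intro: rel_zero rel_add)

lemma rel_prod:
  "finite I \<Longrightarrow> (\<And>i. i \<in> I \<Longrightarrow> f i \<in> rel (a i)) \<Longrightarrow> (\<lambda>x. \<Prod>i\<in>I. f i x) \<in> rel (\<Sum>i\<in>I. a i)"
  by (induction I rule: finite_induct) (auto intro: rel_const rel_mult)

lemma rel_power: "f \<in> rel a \<Longrightarrow> (\<lambda>x. f x ^ k) \<in> rel (a * k)"
  by (induction k) (auto intro: rel_const rel_mult)

lemma \<sigma>_power_cong:
  assumes "x \<in> carrier G" "[a = b] (mod m)"
  shows "\<sigma> x ^ a = \<sigma> x ^ b"
proof -
  obtain k where k: "\<sigma> x = \<sigma> \<delta> ^ k"
    using primitive_root_powers[OF \<delta>_primitive m_pos \<sigma>_root[OF assms(1)]] by metis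
  have "[k * a = k * b] (mod m)" using assms(2) by (rule cong_scalar_left)
  then show ?thesis
    unfolding k power_mult[symmetric]
    by (simp add: primitive_root_power_eq_iff[OF \<delta>_primitive m_pos])
qed

lemma rel_cong: "[a = b] (mod m) \<Longrightarrow> rel a = rel b"
  by (auto simp: relative_invariant_polys_def \<sigma>_power_cong)

text \<open>Two group elements with the same character value differ by an element of the kernel,
  which \<open>f\<close> does not see. So only \<sigma> matters for the action on \<open>f\<close>,
  and any element may be traded for a power of \<delta>.\<close>

lemma invK_act_eq:
  assumes f: "f \<in> invK" and x: "x \<in> carrier G" and y: "y \<in> carrier G" and eq: "\<sigma> x = \<sigma> y"
  shows "f (act x v) = f (act y v)"
proof -
  define \<kappa> where "\<kappa> = x \<otimes> inv y"
  have \<kappa>: "\<kappa> \<in> carrier G" "\<kappa> \<otimes> y = x" using x y by (auto simp: \<kappa>_def m_assoc)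
  then have "\<sigma> \<kappa> * \<sigma> y = \<sigma> y" using \<sigma>_mult[OF \<kappa>(1) y] eq by simp
  then have "\<kappa> \<in> kernel G (root_of_unity_group m) \<sigma>"
    using \<kappa>(1) \<sigma>_nonzero[OF y] by (auto simp: kernel_def root_of_unity_group_def)
  then have "f (act \<kappa> (act y v)) = f (act y v)" using f by (auto simp: invariant_polys_def)
  then show ?thesis using act_mult[OF \<kappa>(1) y] \<kappa>(2) by simp
qed

section \<open>The relative Reynolds operators\<close>

lemma reynolds_poly:
  assumes "f \<in> polynomial_functions smul"
  shows "R j f \<in> polynomial_functions smul"
proof -
  have comp: "(\<lambda>x. f (act (\<delta> [^] k) x)) \<in> polynomial_functions smul" for k :: nat
    by (rule polynomial_functions_compose_linear[OF act_linear assms]) (simp add: \<delta>_carrier)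
  show ?thesis
    unfolding reynolds_def polynomial_functions_def
    by (rule algebra_generated.mult[OF algebra_generated.const])
       (rule algebra_generated_sum,
        rule algebra_generated.mult[OF algebra_generated.const comp[unfolded polynomial_functions_def]])
qed

text \<open>Moving the argument by \<delta> shifts the summation index by one. Restoring the weights
  costs the factor \<open>\<sigma> \<delta> ^ j\<close>, and the shifted sum closes up because its
  new last term \<open>h m\<close> equals the lost first term \<open>h 0\<close>.\<close>

lemma reynolds_\<delta>:
  assumes f: "f \<in> invK"
  shows "R j f (act \<delta> x) = \<sigma> \<delta> ^ j * R j f x"
proof -
  define h where "h k = cnj (\<sigma> \<delta> ^ (j * k)) * f (act (\<delta> [^] k) x)" for k :: nat
  have c: "cnj (\<sigma> \<delta> ^ j) * \<sigma> \<delta> ^ j = 1"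
    by (simp add: cnj_\<sigma> \<delta>_carrier flip: power_mult_distrib)
  \<comment> \<open>The power \<open>\<delta> [^] m\<close> need not be the identity, but its
    character value is 1, and that is enough for \<open>f\<close>.\<close>
  have "f (act (\<delta> [^] m) x) = f (act \<one> x)"
    by (rule invK_act_eq[OF f]) (auto simp: \<delta>_carrier \<sigma>_pow \<sigma>_one \<sigma>_root)
  moreover have "\<sigma> \<delta> ^ (j * m) = 1"
    by (simp add: mult.commute[of j] power_mult \<sigma>_root \<delta>_carrier)
  ultimately have per: "h m = h 0" by (simp add: h_def)
  have step: "cnj (\<sigma> \<delta> ^ (j * k)) * f (act (\<delta> [^] k) (act \<delta> x)) = \<sigma> \<delta> ^ j * h (Suc k)" for k
  proof -
    have "\<sigma> \<delta> ^ j * h (Suc k) =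
      (cnj (\<sigma> \<delta> ^ j) * \<sigma> \<delta> ^ j) * (cnj (\<sigma> \<delta> ^ (j * k)) * f (act (\<delta> [^] Suc k) x))"
      by (simp add: h_def power_add)
    also have "\<dots> = cnj (\<sigma> \<delta> ^ (j * k)) * f (act (\<delta> [^] k) (act \<delta> x))"
      unfolding c by (simp add: act_mult \<delta>_carrier)
    finally show ?thesis ..
  qed
  have "(\<Sum>k<m. h (Suc k)) = (\<Sum>k<m. h k)"
    using sum.lessThan_Suc_shift[of h m] per by simp
  then show ?thesis
    unfolding reynolds_def step by (simp flip: sum_distrib_left add: h_def)
qed

text \<open>Each summand is already invariant: for \<gamma> in the kernel,
  \<open>\<delta> [^] k \<otimes> \<gamma>\<close> and \<open>\<delta> [^] k\<close> have the same
  character value. This does the work of normality of the kernel.\<close>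

lemma reynolds_invK:
  assumes f: "f \<in> invK"
  shows "R j f \<in> invK"
proof -
  have "f (act (\<delta> [^] k) (act \<gamma> x)) = f (act (\<delta> [^] k) x)"
    if "\<gamma> \<in> carrier G" "\<sigma> \<gamma> = 1" for \<gamma> x and k :: nat
    using invK_act_eq[OF f, of "\<delta> [^] k \<otimes> \<gamma>" "\<delta> [^] k" x] that
    by (simp add: \<delta>_carrier act_mult \<sigma>_mult)
  then show ?thesis
    using f reynolds_poly[of f j]
    by (auto simp: invariant_polys_def kernel_def root_of_unity_group_def reynolds_def)
qed

text \<open>On the kernel invariant \<open>R j f\<close>, an element \<gamma> acts like the power of
  \<delta> with the same character value, and for powers of \<delta> the rule
  \<open>reynolds_\<delta>\<close> is iterated.\<close>

lemma reynolds_rel: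
  assumes f: "f \<in> invK"
  shows "R j f \<in> rel j"
proof (rule relI)
  show "R j f \<in> polynomial_functions smul"
    using f by (intro reynolds_poly) (auto simp: invariant_polys_def)
next
  fix \<gamma> x assume \<gamma>: "\<gamma> \<in> carrier G"
  obtain t where t: "\<sigma> \<gamma> = \<sigma> \<delta> ^ t"
    using primitive_root_powers[OF \<delta>_primitive m_pos \<sigma>_root[OF \<gamma>]] by metis
  have "R j f (act (\<delta> [^] t) x) = (\<sigma> \<delta> ^ j) ^ t * R j f x"
  proof (induction t arbitrary: x)
    case (Suc t)
    then show ?case by (simp add: act_mult \<delta>_carrier reynolds_\<delta>[OF f] mult_ac)
  qed (simp add: act_one)
  moreover have "R j f (act \<gamma> x) = R j f (act (\<delta> [^] t) x)"
    by (rule invK_act_eq[OF reynolds_invK[OF f]]) (auto simp: \<gamma> \<delta>_carrier \<sigma>_pow t)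
  ultimately show "R j f (act \<gamma> x) = \<sigma> \<gamma> ^ j * R j f x"
    by (simp add: t mult.commute flip: power_mult)
qed

text \<open>Fourier inversion on the cyclic group: after exchanging the sums,
  \<open>f (act (\<delta> [^] k) x)\<close> is multiplied by a geometric sum over \<open>j\<close>
  that vanishes for \<open>0 < k < m\<close> and equals \<open>m\<close> for
  \<open>k = 0\<close>.\<close>

lemma sum_reynolds: "(\<Sum>j<m. R j f x) = f x"
proof -
  let ?c = "\<lambda>k. cnj (\<sigma> \<delta> ^ k)"
  have one: "?c k = 1 \<longleftrightarrow> k = 0" if "k < m" for k
  proof -
    have "?c k = 1 \<longleftrightarrow> \<sigma> \<delta> ^ k = \<sigma> \<delta> ^ 0"
      by (metis complex_cnj_cancel_iff complex_cnj_one power_0)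
    then show ?thesis
      using primitive_root_power_eq_iff[OF \<delta>_primitive m_pos, of k 0] that by (simp add: cong_def)
  qed
  have root: "?c k ^ m = 1" for k
    by (metis \<delta>_carrier \<sigma>_root complex_cnj_one complex_cnj_power power_mult mult.commute power_one)
  have pow: "cnj (\<sigma> \<delta> ^ (j * k)) = ?c k ^ j" for j k
    by (metis complex_cnj_power mult.commute power_mult)
  have "(\<Sum>j<m. R j f x) = (\<Sum>j<m. \<Sum>k<m. 1 / of_nat m * f (act (\<delta> [^] k) x) * ?c k ^ j)"
    unfolding reynolds_def sum_distrib_left pow
    by (simp only: mult_ac)
  also have "\<dots> = (\<Sum>k<m. 1 / of_nat m * f (act (\<delta> [^] k) x) * (\<Sum>j<m. ?c k ^ j))"
    unfolding sum_distrib_left by (rule sum.swap)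
  also have "\<dots> = (\<Sum>k<m. if k = 0 then f x else 0)"
    unfolding sum_powers_root_of_unity[OF root]
    by (intro sum.cong refl) (use m_pos one in \<open>auto simp: act_one simp del: complex_cnj_power\<close>)
  also have "\<dots> = f x" using m_pos by simp
  finally show ?thesis .
qed

text \<open>On \<open>rel a\<close> the powers of \<delta> act by scalars, so the defining sum is
  geometric. Its ratio \<open>?z\<close> is 1 exactly when \<open>a\<close> and \<open>j\<close> are
  congruent modulo \<open>m\<close>.\<close>

lemma reynolds_of_rel:
  assumes f: "f \<in> rel a"
  shows "R j f = (if [a = j] (mod m) then f else (\<lambda>_. 0))"
proof
  fix x
  let ?z = "cnj (\<sigma> \<delta> ^ j) * \<sigma> \<delta> ^ a"
  have c: "\<sigma> \<delta> ^ j * cnj (\<sigma> \<delta> ^ j) = 1"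
    using cnj_\<sigma>[OF \<delta>_carrier] by (simp add: mult.commute flip: power_mult_distrib)
  have "?z = 1 \<longleftrightarrow> \<sigma> \<delta> ^ a = \<sigma> \<delta> ^ j"
  proof
    assume "?z = 1"
    then have "\<sigma> \<delta> ^ j * ?z = \<sigma> \<delta> ^ j" by (simp only: mult_1_right)
    then show "\<sigma> \<delta> ^ a = \<sigma> \<delta> ^ j" unfolding mult.assoc[symmetric] c by simp
  next
    assume "\<sigma> \<delta> ^ a = \<sigma> \<delta> ^ j"
    then show "?z = 1" using c by (simp only: mult.commute)
  qed
  then have one: "?z = 1 \<longleftrightarrow> [a = j] (mod m)"
    by (simp add: primitive_root_power_eq_iff[OF \<delta>_primitive m_pos])
  have p: "(\<sigma> \<delta> ^ b) ^ m = 1" for b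
    by (metis \<delta>_carrier \<sigma>_root mult.commute power_mult power_one)
  have root: "?z ^ m = 1"
    by (metis p complex_cnj_one complex_cnj_power mult_1 power_mult_distrib)
  have "cnj (\<sigma> \<delta> ^ (j * k)) * f (act (\<delta> [^] k) x) = ?z ^ k * f x" for k
  proof -
    have "(\<sigma> \<delta> ^ k) ^ a = (\<sigma> \<delta> ^ a) ^ k" by (metis mult.commute power_mult)
    moreover have "f (act (\<delta> [^] k) x) = (\<sigma> \<delta> ^ k) ^ a * f x"
      using rel_act[OF f] \<delta>_carrier by (simp add: \<sigma>_pow)
    ultimately show ?thesis by (simp add: power_mult power_mult_distrib)
  qed
  then have "R j f x = 1 / of_nat m * (\<Sum>k<m. ?z ^ k * f x)"
    unfolding reynolds_def by simp
  also have "\<dots> = 1 / of_nat m * ((if [a = j] (mod m) then of_nat m else 0) * f x)"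
    unfolding sum_distrib_right[symmetric] sum_powers_root_of_unity[OF root] one ..
  also have "\<dots> = (if [a = j] (mod m) then f else (\<lambda>_. 0)) x"
    using m_pos by simp
  finally show "R j f x = (if [a = j] (mod m) then f else (\<lambda>_. 0)) x" .
qed

lemma reynolds_sum: "R j (\<lambda>x. \<Sum>i\<in>I. f i x) x = (\<Sum>i\<in>I. R j (f i) x)"
  unfolding reynolds_def sum_distrib_left by (rule sum.swap)

section \<open>Monomials in the Reynolds projections\<close>

definition monom_weight :: "nat \<Rightarrow> (nat \<Rightarrow> nat \<Rightarrow> nat) \<Rightarrow> nat" where
  "monom_weight s \<alpha> = (\<Sum>l = 1..m - 1. l * (\<Sum>i = 1..s. \<alpha> l i))"

definition reynolds_monom ::
    "nat \<Rightarrow> (nat \<Rightarrow> 'v \<Rightarrow> complex) \<Rightarrow> (nat \<Rightarrow> nat \<Rightarrow> nat) \<Rightarrow> 'v \<Rightarrow> complex" where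
  "reynolds_monom s u \<alpha> = (\<lambda>x. \<Prod>l = 1..m - 1. \<Prod>i = 1..s. R l (u i) x ^ \<alpha> l i)"

lemma reynolds_monom_rel:
  assumes "u ` {1..s} \<subseteq> invK"
  shows "reynolds_monom s u \<alpha> \<in> rel (monom_weight s \<alpha>)"
  \<comment> \<open>Distributing \<open>l\<close> over the inner sum turns the weight into a sum of
    the terms \<open>l * \<alpha> l i\<close>, the degrees that \<open>rel_power\<close> and
    \<open>rel_prod\<close> produce.\<close>
  unfolding reynolds_monom_def monom_weight_def sum_distrib_left
  using assms by (intro rel_prod rel_power reynolds_rel) auto

lemma reynolds_monom_mult:
  "(\<lambda>x. reynolds_monom s u \<alpha> x * reynolds_monom s u \<beta> x) =
   reynolds_monom s u (\<lambda>l i. \<alpha> l i + \<beta> l i)"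
  by (simp add: reynolds_monom_def power_add prod.distrib)

lemma reynolds_monom_0: "reynolds_monom s u (\<lambda>_ _. 0) = (\<lambda>_. 1)"
  by (simp add: reynolds_monom_def)

lemma reynolds_monom_single:
  assumes "l \<in> {1..m - 1}" "i \<in> {1..s}"
  shows "reynolds_monom s u (\<lambda>l' i'. if l' = l \<and> i' = i then 1 else 0) = R l (u i)"
proof
  fix x
  have "(\<Prod>i' = 1..s. R l' (u i') x ^ (if l' = l \<and> i' = i then 1 else 0)) =
        (if l' = l then R l (u i) x else 1)" for l'
  proof (cases "l' = l")
    case True
    have "(\<Prod>i' = 1..s. R l (u i') x ^ (if i' = i then 1 else 0)) =
          (\<Prod>i' = 1..s. if i' = i then R l (u i') x else 1)"
      by (intro prod.cong) auto
    then show ?thesis using True assms(2) by simp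
  qed simp
  then show "reynolds_monom s u (\<lambda>l' i'. if l' = l \<and> i' = i then 1 else 0) x = R l (u i) x"
    unfolding reynolds_monom_def using assms(1) by simp
qed

text \<open>The span is closed under products because monomials multiply by adding exponents. It
  therefore suffices that it contains the constants and each \<open>u i\<close>, the latter being
  the sum of its projections.\<close>

lemma algebra_subset_module_span:
  assumes u: "u ` {1..s} \<subseteq> invK"
  shows "algebra_generated (u ` {1..s}) \<subseteq> module_span inv\<Gamma> (range (reynolds_monom s u))"
proof
  let ?S = "module_span inv\<Gamma> (range (reynolds_monom s u))"
  note inv = rel_0[symmetric]
  have zero: "(\<lambda>_. 0) \<in> inv\<Gamma>" by (simp add: inv rel_const)
  have inv_add: "(\<lambda>x. p x + q x) \<in> inv\<Gamma>" if "p \<in> inv\<Gamma>" "q \<in> inv\<Gamma>" for p q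
    using that by (simp add: inv rel_add)
  have inv_mult: "(\<lambda>x. p x * q x) \<in> inv\<Gamma>" if "p \<in> inv\<Gamma>" "q \<in> inv\<Gamma>" for p q
    using that rel_mult[of p 0 q 0] by (simp add: inv)
  have mono: "(\<lambda>x. h x * k x) \<in> range (reynolds_monom s u)"
    if "h \<in> range (reynolds_monom s u)" "k \<in> range (reynolds_monom s u)" for h k
    using that by (auto simp: reynolds_monom_mult)
  \<comment> \<open>The monomial with all exponents zero is 1, so the coefficient ring itself lies
    in the span.\<close>
  have inv_sub: "p \<in> ?S" if "p \<in> inv\<Gamma>" for p
    using module_span_term[OF that rangeI[of "reynolds_monom s u" "\<lambda>_ _. 0"]]
    by (simp add: reynolds_monom_0)
  have mono_sub: "h \<in> ?S" if "h \<in> range (reynolds_monom s u)" for h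
    using module_span_term[of "\<lambda>_. 1" inv\<Gamma> h] that by (simp add: inv rel_const)
  fix f assume "f \<in> algebra_generated (u ` {1..s})"
  then show "f \<in> ?S"
  proof induction
    case (generator f)
    then obtain i where i: "i \<in> {1..s}" "f = u i" by auto
    have "R l (u i) \<in> ?S" if "l < m" for l
    proof (cases "l = 0")
      \<comment> \<open>The index 0 does not occur in the monomials; \<open>R 0 (u i)\<close> is
        invariant under the whole group and enters as a coefficient.\<close>
      case True
      have "u i \<in> invK" using u i(1) by auto
      from inv_sub[OF reynolds_rel[OF this, of 0, unfolded rel_0]] show ?thesis
        using True by simp
    next
      case False
      then have "l \<in> {1..m - 1}" using that by auto
      from reynolds_monom_single[OF this i(1), of u] show ?thesis
        by (metis mono_sub rangeI)
    qed
    then have "(\<lambda>x. \<Sum>l<m. R l (u i) x) \<in> ?S"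
      by (intro module_span_sum zero inv_add) auto
    then show ?case by (simp add: sum_reynolds i(2))
  next
    case (const c)
    show ?case by (rule inv_sub) (simp add: inv rel_const)
  next
    case (add f g)
    show ?case by (rule module_span_add[OF zero inv_add add.IH])
  next
    case (mult f g)
    show ?case by (rule module_span_mult[OF zero inv_add inv_mult mono mult.IH])
  qed
qed

theorem relative_invariants_generated:
  assumes basis: "hilbert_basis invK (u ` {1..s})"
  shows "generates_module inv\<Gamma> (rel j)
    {reynolds_monom s u \<alpha> | \<alpha>. [monom_weight s \<alpha> = j] (mod m)}" (is "generates_module _ _ ?M")
proof -
  have u: "u ` {1..s} \<subseteq> invK" and gen: "algebra_generated (u ` {1..s}) = invK"
    using basis by (auto simp: hilbert_basis_def)
  have M: "?M \<subseteq> rel j"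
    using reynolds_monom_rel[OF u] rel_cong by blast
  have "rel j = module_span inv\<Gamma> ?M"
  proof
    show "module_span inv\<Gamma> ?M \<subseteq> rel j"
    proof
      fix f assume "f \<in> module_span inv\<Gamma> ?M"
      then obtain F p where F: "F \<subseteq> ?M" "\<forall>h\<in>F. p h \<in> rel 0"
        and f: "f = (\<lambda>x. \<Sum>h\<in>F. p h x * h x)"
        unfolding module_span_def rel_0 by blast
      show "f \<in> rel j" unfolding f
      proof (rule rel_sum)
        fix h assume "h \<in> F"
        then show "(\<lambda>x. p h x * h x) \<in> rel j"
          using rel_mult[of "p h" 0 h j] F M by auto
      qed
    qed
    show "rel j \<subseteq> module_span inv\<Gamma> ?M"
    proof
      fix f assume f: "f \<in> rel j"
      then have "f \<in> module_span inv\<Gamma> (range (reynolds_monom s u))"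
        using rel_subset_invK gen algebra_subset_module_span[OF u] by blast
      then obtain F p where F: "finite F" "F \<subseteq> range (reynolds_monom s u)" "\<forall>h\<in>F. p h \<in> rel 0"
        and f_eq: "f = (\<lambda>x. \<Sum>h\<in>F. p h x * h x)"
        unfolding module_span_def rel_0 by blast
      \<comment> \<open>The coefficient \<open>p h\<close> has degree 0, so the term has the degree
        of the monomial \<open>h\<close>, and \<open>R j\<close> either fixes it or kills
        it.\<close>
      have proj: "R j (\<lambda>x. p h x * h x) = (if h \<in> ?M then (\<lambda>x. p h x * h x) else (\<lambda>_. 0))"
        if h: "h \<in> F" for h
      proof -
        obtain \<alpha> where \<alpha>: "h = reynolds_monom s u \<alpha>" using F(2) h by blast
        have rel: "(\<lambda>x. p h x * h x) \<in> rel a" if "h \<in> rel a" for a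
          using rel_mult[of "p h" 0 h a] F(3) h that by auto
        show ?thesis
        \<comment> \<open>The split is on membership of \<open>h\<close>, not on the weight of the
          chosen \<alpha>: one function can arise from several exponent families, and when it is
          zero their weights may differ modulo \<open>m\<close>.\<close>
        proof (cases "h \<in> ?M")
          case True
          then have "h \<in> rel j" using M by blast
          from reynolds_of_rel[OF rel[OF this], of j] True show ?thesis by simp
        next
          case False
          then have "\<not> [monom_weight s \<alpha> = j] (mod m)" using \<alpha> by blast
          moreover have "h \<in> rel (monom_weight s \<alpha>)" using reynolds_monom_rel[OF u] \<alpha> by simp
          ultimately have "R j (\<lambda>x. p h x * h x) = (\<lambda>_. 0)" using reynolds_of_rel[OF rel] by simp
          then show ?thesis using False by (simp only: if_False)
        qed
      qed
      \<comment> \<open>Since \<open>R j\<close> fixes \<open>f\<close>, applying it to the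
        expansion of \<open>f\<close> term by term discards every monomial outside \<open>?M\<close>
        and leaves the other terms, with their coefficients, untouched.\<close>
      have "f = R j f" using reynolds_of_rel[OF f, of j] by simp
      also have "\<dots> = (\<lambda>x. \<Sum>h\<in>F. R j (\<lambda>x. p h x * h x) x)"
        unfolding f_eq by (rule ext) (rule reynolds_sum)
      also have "\<dots> = (\<lambda>x. \<Sum>h\<in>F \<inter> ?M. p h x * h x)"
        by (rule ext, rule sum.mono_neutral_cong_right) (use F(1) in \<open>auto simp: proj\<close>)
      also have "\<dots> \<in> module_span inv\<Gamma> ?M"
        unfolding module_span_def using F(1,3) rel_0
        by (intro CollectI exI[of _ "F \<inter> ?M"] exI[of _ p]) auto
      finally show "f \<in> module_span inv\<Gamma> ?M" .
    qed
  qed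
  then show ?thesis using M by (simp add: generates_module_def module_span_def)
qed

end

theorem theorem4p1:
  fixes m n s :: nat
    and G :: "('a, 'm) monoid_scheme" and T :: "'a topology" and A :: "'a chart set"
    and smul :: "complex \<Rightarrow> 'v::ab_group_add \<Rightarrow> 'v" and B :: "'v set"
    and act :: "'a \<Rightarrow> 'v \<Rightarrow> 'v"
    and \<sigma> :: "'a \<Rightarrow> complex" and \<delta> :: 'a
    and u :: "nat \<Rightarrow> 'v \<Rightarrow> complex"
  assumes "m \<ge> 2"
    and "compact_lie_group n A T G"
    and "finite_dimensional_vector_space smul B"
    and "acts_linearly G T smul B act"
    and "\<sigma> \<in> epi G (root_of_unity_group m)"
    and "\<delta> \<in> carrier G" and "primitive_root_of_unity m (\<sigma> \<delta>)"
    and "hilbert_basis (invariant_polys smul act (kernel G (root_of_unity_group m) \<sigma>)) (u ` {1..s})"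
  shows "\<forall>j\<in>{1..m - 1}.
    generates_module (invariant_polys smul act (carrier G))
      (relative_invariant_polys smul act (carrier G) \<sigma> j)
      {\<lambda>x. \<Prod>l = 1..m - 1. \<Prod>i = 1..s. reynolds G act \<sigma> \<delta> m l (u i) x ^ \<alpha> l i | \<alpha> :: nat \<Rightarrow> nat \<Rightarrow> nat.
         [(\<Sum>l = 1..m - 1. l * (\<Sum>i = 1..s. \<alpha> l i)) = j] (mod m)}"
proof
  fix j
  \<comment> \<open>The linear action supplies the group action and the linearity of each
    \<open>act \<gamma>\<close>, the epimorphism supplies the homomorphism \<sigma>, and
    \<open>m \<ge> 2\<close> gives \<open>m > 0\<close>.\<close>
  interpret cyclic_character G smul act \<sigma> \<delta> m
    by (rule cyclic_character.intro)
       (use assms(1,4-7) in \<open>auto simp only: acts_linearly_def epi_def\<close>)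
  show "generates_module (invariant_polys smul act (carrier G))
      (relative_invariant_polys smul act (carrier G) \<sigma> j)
      {\<lambda>x. \<Prod>l = 1..m - 1. \<Prod>i = 1..s. reynolds G act \<sigma> \<delta> m l (u i) x ^ \<alpha> l i | \<alpha> :: nat \<Rightarrow> nat \<Rightarrow> nat.
         [(\<Sum>l = 1..m - 1. l * (\<Sum>i = 1..s. \<alpha> l i)) = j] (mod m)}"
    using relative_invariants_generated[OF assms(8), of j]
    unfolding reynolds_monom_def monom_weight_def .
qed

end
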